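(* Suppose $(\lambda,\mu)$ is a Hilbert basis element of ${\sf Kostka}_r^{\mathbb Z}$. Then $\lambda_1\le r$. Moreover, if $\lambda_1=r$ then $\lambda$ and $\mu$ are both rectangles (i.e., all nonzero parts of $\lambda$ are equal, and all nonzero parts of $\mu$ are equal).
   Context: Fix a positive integer $r$. ${\sf Kostka}_r$ is the cone of $(\lambda,\mu)\in\mathbb{R}^{2r}$ with $\lambda_1\ge\cdots\ge\lambda_r\ge0$, $\mu_1\ge\cdots\ge\mu_r\ge0$, $\sum_{i=1}^t\lambda_i\ge\sum_{i=1}^t\mu_i$ for $1\le t\le r-1$, and $\sum_{i=1}^r\lambda_i=\sum_{i=1}^r\mu_i$. ${\sf Kostka}_r^{\mathbb Z}={\sf Kostka}_r\cap\mathbb{Z}^{2r}$ is a semigroup (pairs of partitions with at most $r$ parts, $\lambda$ dominating $\mu$). Its Hilbert basis is the set of nonzero elements of ${\sf Kostka}_r^{\mathbb Z}$ that are not the sum of two nonzero elements of ${\sf Kostka}_r^{\mathbb Z}$. *)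

theory Defs
  imports Complex_Main "HOL-Library.Function_Algebras" "HOL-Library.Product_Plus"
begin

text \<open>
  A vector of \<open>\<real>\<^sup>r\<close> is a function \<open>nat \<Rightarrow> real\<close> with entries indexed by \<open>1, \<dots>, r\<close> and value
  \<open>0\<close> at every other index, so that equality, \<open>0\<close> and \<open>+\<close> of functions (and of pairs of
  functions) are those of \<open>\<real>\<^sup>r\<close> (and of \<open>\<real>\<^sup>2\<^sup>r = \<real>\<^sup>r \<times> \<real>\<^sup>r\<close>).
\<close>

definition rvec :: "nat \<Rightarrow> (nat \<Rightarrow> real) set" where
  "rvec r = {v. \<forall>i. i \<notin> {1..r} \<longrightarrow> v i = 0}"

definition zvec :: "nat \<Rightarrow> (nat \<Rightarrow> real) set" where
  "zvec r = {v \<in> rvec r. \<forall>i\<in>{1..r}. v i \<in> \<int>}"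

definition decreasing_nonneg :: "nat \<Rightarrow> (nat \<Rightarrow> real) \<Rightarrow> bool" where
  "decreasing_nonneg r v \<longleftrightarrow>
     (\<forall>i\<in>{1..<r}. v i \<ge> v (i + 1)) \<and> (\<forall>i\<in>{1..r}. v i \<ge> 0)"

definition Kostka :: "nat \<Rightarrow> ((nat \<Rightarrow> real) \<times> (nat \<Rightarrow> real)) set" where
  "Kostka r = {(l, m). l \<in> rvec r \<and> m \<in> rvec r \<and>
     decreasing_nonneg r l \<and> decreasing_nonneg r m \<and>
     (\<forall>t\<in>{1..r - 1}. (\<Sum>i=1..t. l i) \<ge> (\<Sum>i=1..t. m i)) \<and>
     (\<Sum>i=1..r. l i) = (\<Sum>i=1..r. m i)}"

definition Kostka_Z :: "nat \<Rightarrow> ((nat \<Rightarrow> real) \<times> (nat \<Rightarrow> real)) set" where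
  "Kostka_Z r = Kostka r \<inter> (zvec r \<times> zvec r)"

definition hilbert_basis :: "'a::monoid_add set \<Rightarrow> 'a set" where
  "hilbert_basis S =
     {x \<in> S. x \<noteq> 0 \<and> \<not> (\<exists>a\<in>S. \<exists>b\<in>S. a \<noteq> 0 \<and> b \<noteq> 0 \<and> x = a + b)}"

definition rectangle :: "nat \<Rightarrow> (nat \<Rightarrow> real) \<Rightarrow> bool" where
  "rectangle r v \<longleftrightarrow>
     (\<forall>i\<in>{1..r}. \<forall>j\<in>{1..r}. v i \<noteq> 0 \<longrightarrow> v j \<noteq> 0 \<longrightarrow> v i = v j)"

end

theory Submission
  imports Defs "HOL-Library.Multiset"
begin

text \<open>
  Encode \<open>\<lambda>\<close> by the multiset \<open>A\<close> of its column heights and \<open>\<mu>\<close> by the multiset \<open>B\<close> of its column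
  heights, padded with zeros to \<open>n = \<lambda>\<^sub>1\<close> columns. Dominance says that \<open>B\<close> majorizes \<open>A\<close>.
  Start with any column \<open>h\<^sub>1 \<in> B\<close> and repeatedly choose unused \<open>a\<^sub>k \<in> A\<close> and \<open>b\<^sub>k \<in> B\<close> with \<open>a\<^sub>k\<close>
  strictly between \<open>h\<^sub>k\<close> and \<open>b\<^sub>k\<close>, replacing \<open>{h\<^sub>k, b\<^sub>k}\<close> by \<open>{a\<^sub>k, h\<^sub>k\<^sub>+\<^sub>1}\<close> with the same sum; the choice
  can be made so that what remains of \<open>B\<close>, together with \<open>h\<^sub>k\<^sub>+\<^sub>1\<close>, still majorizes what remains
  of \<open>A\<close>. If \<open>h\<^sub>i = h\<^sub>j\<close> for some \<open>i < j\<close>, the columns used between these two times split off, so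
  for a Hilbert basis element \<open>h\<^sub>1, \<dots>, h\<^sub>n\<close> are distinct. Since \<open>h\<^sub>2, \<dots>, h\<^sub>n\<close> lie strictly
  between \<open>0\<close> and \<open>r\<close>, this gives \<open>n \<le> r\<close>. If \<open>n = r\<close>, they exhaust \<open>1, \<dots>, r - 1\<close>, so the arbitrary
  column \<open>h\<^sub>1\<close> of \<open>\<mu>\<close> is \<open>0\<close> or \<open>r\<close>; then every subset of \<open>A\<close> with sum divisible by \<open>r\<close>
  splits off, and a minimal zero-sum sequence of length \<open>r\<close> modulo \<open>r\<close> is constant.
\<close>

section \<open>Majorization of integer multisets\<close>

definition deviation :: "int multiset \<Rightarrow> int \<Rightarrow> int" where
  "deviation A t = (\<Sum>x\<in>#A. \<bar>x - t\<bar>)"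

text \<open>Majorization in Hardy-Littlewood-Polya form: for equal size and sum, testing the convex
  functions |x - t| replaces sorted partial sums. Union and cancellation of common elements then
  work termwise.\<close>

definition majorizes :: "int multiset \<Rightarrow> int multiset \<Rightarrow> bool" where
  "majorizes B A \<longleftrightarrow>
     size B = size A \<and> \<Sum>\<^sub># B = \<Sum>\<^sub># A \<and> (\<forall>t. deviation A t \<le> deviation B t)"

text \<open>Since \<open>majorizes\<close> forces equal sizes, a part of \<open>B\<close> is empty
  exactly when the matching part of \<open>A\<close> is.\<close>

definition indecomposable :: "int multiset \<Rightarrow> int multiset \<Rightarrow> bool" where
  "indecomposable B A \<longleftrightarrow>
     (\<forall>A1 A2 B1 B2. A = A1 + A2 \<longrightarrow> B = B1 + B2 \<longrightarrow> majorizes B1 A1 \<longrightarrow> majorizes B2 A2 \<longrightarrow>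
        A1 = {#} \<or> A2 = {#})"

lemma deviation_simps [simp]:
  "deviation {#} t = 0"
  "deviation (add_mset x A) t = \<bar>x - t\<bar> + deviation A t"
  "deviation (A + B) t = deviation A t + deviation B t"
  by (simp_all add: deviation_def)

lemma majorizes_refl [simp]: "majorizes A A"
  by (simp add: majorizes_def)

lemma majorizes_trans: "majorizes C B \<Longrightarrow> majorizes B A \<Longrightarrow> majorizes C A"
  unfolding majorizes_def by (metis order_trans)

lemma majorizes_add: "majorizes B A \<Longrightarrow> majorizes B' A' \<Longrightarrow> majorizes (B + B') (A + A')"
  by (auto simp: majorizes_def intro: add_mono)

lemma majorizes_cancel_add_mset [simp]:
  "majorizes (add_mset x B) (add_mset x A) \<longleftrightarrow> majorizes B A"
  by (simp add: majorizes_def)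

text \<open>Both \<open>a\<close> and \<open>h + b - a\<close> lie between \<open>h\<close> and
  \<open>b\<close>, so this is convexity of |x - t|.\<close>

lemma majorizes_pair:
  assumes "(b \<le> a \<and> a \<le> h) \<or> (h \<le> a \<and> a \<le> b)"
  shows "majorizes {#h, b#} {#a, h + b - a#}"
  using assms by (auto simp: majorizes_def)

lemma indecomposableD:
  assumes "indecomposable B A" "A = A1 + A2" "B = B1 + B2" "majorizes B1 A1" "majorizes B2 A2"
  shows "A1 = {#} \<or> A2 = {#}"
  using assms unfolding indecomposable_def by blast

section \<open>Slopes of the deviation and the exchange step\<close>

text \<open>Passing from \<open>t\<close> to \<open>t + 1\<close> adds 1 for each element at most
  \<open>t\<close> and subtracts 1 for every other one. For equal sizes, a difference of deviations
  therefore has slope twice a difference of counts.\<close>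

lemma deviation_step:
  "deviation A (t + 1) = deviation A t + 2 * int (size (filter_mset (\<lambda>x. x \<le> t) A)) - int (size A)"
  by (induction A) auto

lemma size_filter_le_step:
  "size (filter_mset (\<lambda>x. x \<le> t) A) = size (filter_mset (\<lambda>x. x \<le> t - 1) A) + count A (t::int)"
  by (induction A) auto

lemma deviation_below:
  "(\<And>x. x \<in># A \<Longrightarrow> t \<le> x) \<Longrightarrow> deviation A t = \<Sum>\<^sub># A - int (size A) * t"
  by (induction A) (auto simp: algebra_simps)

lemma last_int:
  fixes lo hi :: int
  assumes "lo \<le> hi" "P lo"
  obtains a where "lo \<le> a" "a \<le> hi" "P a" "\<And>t. a < t \<Longrightarrow> t \<le> hi \<Longrightarrow> \<not> P t"
proof -
  let ?S = "{x\<in>{lo..hi}. P x}"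
  have fin: "finite ?S" by (rule finite_subset[of _ "{lo..hi}"]) auto
  have ne: "lo \<in> ?S" using assms by auto
  have Max: "Max ?S \<in> ?S" using fin ne by (intro Max_in) auto
  show thesis
  proof (rule that)
    fix t assume t: "Max ?S < t" "t \<le> hi"
    show "\<not> P t"
    proof
      assume "P t"
      then have "t \<in> ?S" using t Max by auto
      from Max_ge[OF fin this] t show False by linarith
    qed
  qed (use Max in \<open>simp_all only: mem_Collect_eq atLeastAtMost_iff\<close>)
qed

lemma int_diff_le:
  fixes G :: "int \<Rightarrow> int"
  assumes "u \<le> v" "\<And>t. u \<le> t \<Longrightarrow> t < v \<Longrightarrow> G (t + 1) \<le> G t + c"
  shows "G v \<le> G u + c * (v - u)"
  using assms
proof (induction v rule: int_ge_induct)
  case base then show ?case by simp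
next
  case (step v)
  then have "G v \<le> G u + c * (v - u)" "G (v + 1) \<le> G v + c" by auto
  then show ?case by (simp add: algebra_simps)
qed

text \<open>
  The excess \<open>G = deviation B - deviation A\<close> is piecewise linear with even integer slopes \<open>2 N\<close>.
  Walking left from \<open>h\<close>, the witness \<open>a\<close> is where \<open>G\<close> stops rising at rate at least \<open>2\<close>, \<open>p\<close> is
  where \<open>G\<close> starts to fall, and \<open>b\<close> is where it stops falling. So \<open>G\<close> stays above the excess of
  \<open>{h, b}\<close> over \<open>{a, h + b - a}\<close>.
\<close>

lemma majorizes_step_down:
  assumes maj: "majorizes B A" and h: "h \<in># B"
    and slope: "size (filter_mset (\<lambda>x. x \<le> h - 1) B) < size (filter_mset (\<lambda>x. x \<le> h - 1) A)"
  shows "\<exists>a b A' B'. A = add_mset a A' \<and> B = add_mset h (add_mset b B') \<and> b < a \<and> a < h \<and>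
           majorizes (add_mset (h + b - a) B') A'"
proof -
  define N where "N t = int (size (filter_mset (\<lambda>x. x \<le> t) B)) - int (size (filter_mset (\<lambda>x. x \<le> t) A))"
    for t :: int
  define G where "G t = deviation B t - deviation A t" for t
  have G_step: "G (t + 1) = G t + 2 * N t" for t
    using maj by (simp add: G_def N_def deviation_step majorizes_def)
  have N_step: "N t = N (t - 1) + int (count B t) - int (count A t)" for t
    by (simp add: N_def size_filter_le_step[of t])
  have G_nonneg: "G t \<ge> 0" for t using maj by (simp add: G_def majorizes_def)
  obtain lo where lo: "lo < h" "\<And>x. x \<in># A + B \<Longrightarrow> lo < x"
  proof
    let ?S = "insert h (set_mset (A + B))"
    have "Min ?S - 1 < x" if "x \<in> ?S" for x
      using Min_le[of ?S x, OF _ that] by simp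
    then show "Min ?S - 1 < h" "\<And>x. x \<in># A + B \<Longrightarrow> Min ?S - 1 < x" by blast+
  qed
  have N_low: "N t = 0" if "t \<le> lo" for t
  proof -
    have *: "filter_mset (\<lambda>x. x \<le> t) A = {#}" "filter_mset (\<lambda>x. x \<le> t) B = {#}"
      using lo that by force+
    show ?thesis unfolding N_def * by simp
  qed
  have G_low: "G lo = 0"
    using lo maj deviation_below[of A lo] deviation_below[of B lo]
    by (simp add: G_def majorizes_def less_imp_le)
  obtain a where a: "lo + 1 \<le> a" "a \<le> h" "N (a - 1) \<ge> 0" "\<And>t. a < t \<Longrightarrow> t \<le> h \<Longrightarrow> \<not> N (t - 1) \<ge> 0"
    using last_int[of "lo + 1" h "\<lambda>t. N (t - 1) \<ge> 0"] lo N_low[of lo] by auto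
  have "N (h - 1) < 0" using slope by (simp add: N_def)
  then have ah: "a < h" using a by (cases "a = h") auto
  have N_ah: "N t \<le> -1" if "a \<le> t" "t < h" for t using a(4)[of "t + 1"] that by simp
  \<comment> \<open>By \<open>N_step\<close> the slope can drop only at elements of \<open>A\<close>
    and rise only at elements of \<open>B\<close>; it drops at \<open>a\<close>, and below it rises
    at \<open>b\<close>.\<close>
  have "count A a > 0" using N_step[of a] N_ah[of a] a ah by linarith
  then have aA: "a \<in># A" by simp
  have G_ah: "G t \<ge> 2 * (h - t)" if "a \<le> t" "t \<le> h" for t
  proof -
    have "G h \<le> G t + (-2) * (h - t)"
      by (rule int_diff_le) (use that G_step N_ah in \<open>force+\<close>)
    then show ?thesis using G_nonneg[of h] by simp
  qed
  \<comment> \<open>\<open>G\<close> is 0 at \<open>lo\<close> and at least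
    \<open>2 * (h - a) > 0\<close> at \<open>a\<close>, so it must rise somewhere in
    between.\<close>
  have "\<exists>t. lo \<le> t \<and> t < a \<and> N t \<ge> 1"
  proof (rule ccontr)
    assume "\<not> ?thesis"
    then have "N t \<le> 0" if "lo \<le> t" "t < a" for t using that by force
    then have "G a \<le> G lo + 0 * (a - lo)"
      by (intro int_diff_le) (use a G_step in \<open>force+\<close>)
    then show False using G_ah[of a] ah G_low by simp
  qed
  then obtain p0 where "lo \<le> p0" "p0 < a" "N p0 \<ge> 1" by blast
  then obtain p where p: "p0 + 1 \<le> p" "p \<le> a" "N (p - 1) \<ge> 1" "\<And>t. p < t \<Longrightarrow> t \<le> a \<Longrightarrow> \<not> N (t - 1) \<ge> 1"
    using last_int[of "p0 + 1" a "\<lambda>t. N (t - 1) \<ge> 1"] by auto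
  have G_pa: "G t \<ge> 2 * (h - a)" if "p \<le> t" "t \<le> a" for t
  proof -
    have "G a \<le> G t + 0 * (a - t)"
    proof (rule int_diff_le)
      fix s assume "t \<le> s" "s < a"
      then show "G (s + 1) \<le> G s + 0" using p(4)[of "s + 1"] that G_step[of s] by simp
    qed (use that in simp)
    then show ?thesis using G_ah[of a] ah by simp
  qed
  obtain b where b: "lo \<le> b" "b \<le> p" "N (b - 1) \<le> 0" "\<And>t. b < t \<Longrightarrow> t \<le> p \<Longrightarrow> \<not> N (t - 1) \<le> 0"
    using last_int[of lo p "\<lambda>t. N (t - 1) \<le> 0"] N_low[of "lo - 1"] p \<open>lo \<le> p0\<close> by auto
  have bp: "b < p" using b p by (cases "b = p") auto
  have N_bp: "N t \<ge> 1" if "b \<le> t" "t < p" for t using b(4)[of "t + 1"] that by simp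
  have "count B b > 0" using N_step[of b] N_bp[of b] b bp by linarith
  then have bB: "b \<in># B" by simp
  have G_bp: "G t \<ge> 2 * (t - b)" if "b \<le> t" "t \<le> p" for t
  proof -
    have "- G t \<le> - G b + (-2) * (t - b)"
    proof (rule int_diff_le)
      fix s assume "b \<le> s" "s < t"
      then show "- G (s + 1) \<le> - G s + - 2" using N_bp[of s] that G_step[of s] by simp
    qed (use that in simp)
    then show ?thesis using G_nonneg[of b] by simp
  qed
  obtain A' where A': "A = add_mset a A'" using aA by (meson multi_member_split)
  obtain B'' where B'': "B = add_mset h B''" using h by (meson multi_member_split)
  then have "b \<in># B''" using bB bp p ah by auto
  then obtain B' where "B'' = add_mset b B'" by (meson multi_member_split)
  with B'' have B': "B = add_mset h (add_mset b B')" by simp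
  \<comment> \<open>The left side vanishes outside \<open>{b..h}\<close>. Inside it is a trapezoid,
    bounded by each of \<open>2 * (t - b)\<close>, \<open>2 * (h - a)\<close> and
    \<open>2 * (h - t)\<close>; the three bounds on \<open>G\<close> match these pieces.\<close>
  have "\<bar>h - t\<bar> + \<bar>b - t\<bar> - \<bar>a - t\<bar> - \<bar>h + b - a - t\<bar> \<le> G t" for t
  proof -
    consider "t < b \<or> h < t" | "b \<le> t" "t \<le> p" | "p \<le> t" "t \<le> a" | "a \<le> t" "t \<le> h" by linarith
    then show ?thesis
    proof cases
      case 1
      then show ?thesis using G_nonneg[of t] bp p(2) ah by (auto simp: abs_if)
    next
      case 2
      then show ?thesis using G_bp[OF 2] p(2) ah by (auto simp: abs_if)
    next
      case 3
      then show ?thesis using G_pa[OF 3] bp ah by (auto simp: abs_if)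
    next
      case 4
      then show ?thesis using G_ah[OF 4] bp p(2) by (auto simp: abs_if)
    qed
  qed
  then have "majorizes (add_mset (h + b - a) B') A'"
    using maj by (auto simp: majorizes_def A' B' G_def algebra_simps)
  then show ?thesis using A' B' bp p ah by (intro exI[of _ a] exI[of _ b] exI[of _ A'] exI[of _ B']) auto
qed

lemma deviation_uminus: "deviation (image_mset uminus A) t = deviation A (- t)"
  by (induction A) auto

lemma sum_mset_uminus: "\<Sum>\<^sub># (image_mset uminus A) = - \<Sum>\<^sub># (A :: int multiset)"
  by (induction A) auto

lemma majorizes_uminus:
  "majorizes B A \<Longrightarrow> majorizes (image_mset uminus B) (image_mset uminus A)"
  by (auto simp: majorizes_def deviation_uminus sum_mset_uminus)

lemma uminus_uminus_mset: "image_mset uminus (image_mset uminus A) = (A :: int multiset)"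
  by (induction A) auto

lemma size_filter_uminus:
  "size (filter_mset (\<lambda>x. x \<le> t) (image_mset uminus A)) + size (filter_mset (\<lambda>x. x \<le> - t - 1) A)
     = size (A :: int multiset)"
  by (induction A) auto

text \<open>If the slope of the excess just left of \<open>h\<close> is not negative, then it is
  positive just right of \<open>h\<close>, because \<open>h\<close> occurs in \<open>B\<close> but
  not in \<open>A\<close>. Reflecting at 0 turns this into the hypothesis of
  \<open>majorizes_step_down\<close>.\<close>

lemma majorizes_step:
  assumes maj: "majorizes B A" and h: "h \<in># B" "h \<notin># A"
  obtains a b A' B' where "A = add_mset a A'" "B = add_mset h (add_mset b B')"
    "(b < a \<and> a < h) \<or> (h < a \<and> a < b)" "majorizes (add_mset (h + b - a) B') A'"
proof (cases "size (filter_mset (\<lambda>x. x \<le> h - 1) B) < size (filter_mset (\<lambda>x. x \<le> h - 1) A)")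
  case True
  from majorizes_step_down[OF maj h(1) this] that show ?thesis by blast
next
  case False
  let ?A = "image_mset uminus A" and ?B = "image_mset uminus B"
  have "count B h > 0" "count A h = 0" using h by (auto simp: not_in_iff)
  then have "size (filter_mset (\<lambda>x. x \<le> h) A) < size (filter_mset (\<lambda>x. x \<le> h) B)"
    using False size_filter_le_step[of h A] size_filter_le_step[of h B] by linarith
  then have "size (filter_mset (\<lambda>x. x \<le> - h - 1) ?B) < size (filter_mset (\<lambda>x. x \<le> - h - 1) ?A)"
    using size_filter_uminus[of "- h - 1" A] size_filter_uminus[of "- h - 1" B] maj
    by (simp add: majorizes_def)
  from majorizes_step_down[OF majorizes_uminus[OF maj] _ this] h
  obtain a b A' B' where *: "?A = add_mset a A'" "?B = add_mset (- h) (add_mset b B')" "b < a" "a < - h"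
      "majorizes (add_mset (- h + b - a) B') A'"
    by auto
  have "A = add_mset (- a) (image_mset uminus A')"
    using arg_cong[OF *(1), of "image_mset uminus"] by (simp add: uminus_uminus_mset)
  moreover have "B = add_mset h (add_mset (- b) (image_mset uminus B'))"
    using arg_cong[OF *(2), of "image_mset uminus"] by (simp add: uminus_uminus_mset)
  moreover have "majorizes (add_mset (h + - b - - a) (image_mset uminus B')) (image_mset uminus A')"
    using majorizes_uminus[OF *(5)] by (simp add: algebra_simps)
  ultimately show ?thesis using that[of "- a" _ "- b"] * by simp
qed


section \<open>The chain of exchanges\<close>

lemma majorizes_chain:
  assumes maj: "majorizes B A" and ind: "indecomposable B A" and h0: "h0 \<in># B"
    and range: "\<And>x. x \<in># B \<Longrightarrow> 0 \<le> x \<and> x \<le> r" and "k < size A"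
  shows "\<exists>h P P2 Q Q2 H. A = P + P2 \<and> B = Q + Q2 \<and> size P = k \<and>
     majorizes Q (add_mset h P) \<and> majorizes (add_mset h Q2) P2 \<and>
     H \<subseteq> {1..r - 1} \<and> card H = k \<and> h0 \<notin> H \<and> h \<in> insert h0 H \<and>
     (\<forall>x\<in>insert h0 H. \<exists>P0 P1 Q0 Q1. P = P0 + P1 \<and> Q = Q0 + Q1 \<and> Q0 \<noteq> {#} \<and>
        majorizes Q0 (add_mset x P0) \<and> majorizes (add_mset x Q1) (add_mset h P1))"
  using \<open>k < size A\<close>
proof (induction k)
  case 0
  obtain B' where B': "B = add_mset h0 B'" using h0 by (meson multi_member_split)
  show ?case
    using maj B'
    by (intro exI[of _ h0] exI[of _ "{#}"] exI[of _ A] exI[of _ "{#h0#}"] exI[of _ B'] exI[of _ "{}"])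
      (simp, rule exI[of _ "{#h0#}"], simp)
next
  case (Suc k)
  then obtain h P P2 Q Q2 H where A: "A = P + P2" and B: "B = Q + Q2" and sP: "size P = k"
    and m1: "majorizes Q (add_mset h P)" and m2: "majorizes (add_mset h Q2) P2"
    and H: "H \<subseteq> {1..r - 1}" "card H = k" "h0 \<notin> H" "h \<in> insert h0 H"
    and hist: "\<And>x. x \<in> insert h0 H \<Longrightarrow> \<exists>P0 P1 Q0 Q1. P = P0 + P1 \<and> Q = Q0 + Q1 \<and> Q0 \<noteq> {#} \<and>
        majorizes Q0 (add_mset x P0) \<and> majorizes (add_mset x Q1) (add_mset h P1)"
    by (metis Suc_lessD)
  \<comment> \<open>Otherwise \<open>Q\<close> over \<open>add_mset h P\<close> and
    \<open>Q2\<close> over \<open>P2'\<close> would be a decomposition; \<open>P2'\<close> is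
    nonempty because \<open>Suc k < size A\<close>.\<close>
  have hP2: "h \<notin># P2"
  proof
    assume "h \<in># P2"
    then obtain P2' where P2': "P2 = add_mset h P2'" by (meson multi_member_split)
    have "add_mset h P = {#} \<or> P2' = {#}"
      by (rule indecomposableD[OF ind _ B m1]) (use A P2' m2 in auto)
    then show False using Suc.prems A P2' sP by simp
  qed
  have hQ2: "h \<in># add_mset h Q2" by simp
  obtain a b P2' Q2' where
    P2: "P2 = add_mset a P2'" and "add_mset h Q2 = add_mset h (add_mset b Q2')"
    and ab: "(b < a \<and> a < h) \<or> (h < a \<and> a < b)" and m2': "majorizes (add_mset (h + b - a) Q2') P2'"
    by (rule majorizes_step[OF m2 hQ2 hP2])
  then have Q2: "Q2 = add_mset b Q2'" by simp
  define h' where "h' = h + b - a"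
  have pair: "majorizes (add_mset b (add_mset h X)) (add_mset a (add_mset h' X))" for X
    using majorizes_add[OF majorizes_pair[of b a h] majorizes_refl[of X]] ab
    by (auto simp: h'_def add_mset_commute)
  have "0 \<le> h \<and> h \<le> r" using H range[OF h0] by auto
  moreover have "0 \<le> b \<and> b \<le> r" using range[of b] B Q2 by simp
  ultimately have h'_range: "h' \<in> {1..r - 1}" using ab by (auto simp: h'_def)
  \<comment> \<open>An exchange trades \<open>h\<close>, \<open>b\<close> for \<open>h'\<close>,
    \<open>a\<close>, which moves a majorization ending in \<open>h\<close> to one ending in
    \<open>h'\<close>.\<close>
  have extend: "majorizes (add_mset x (add_mset b Y)) (add_mset h' (add_mset a X))"
    if "majorizes (add_mset x Y) (add_mset h X)" for x X Y
    using majorizes_trans[OF _ pair[of X]] that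
    by (metis add_mset_commute majorizes_cancel_add_mset)
  have new: "h' \<notin> insert h0 H"
  proof
    assume "h' \<in> insert h0 H"
    from hist[OF this] obtain P0 P1 Q0 Q1 where *: "P = P0 + P1" "Q = Q0 + Q1" "Q0 \<noteq> {#}"
      "majorizes Q0 (add_mset h' P0)" "majorizes (add_mset h' Q1) (add_mset h P1)" by blast
    have "majorizes (add_mset b Q1) (add_mset a P1)"
      using extend[OF *(5)] by simp
    moreover have m: "majorizes (Q0 + Q2') (P0 + P2')"
    proof (rule majorizes_trans)
      show "majorizes (Q0 + Q2') (P0 + add_mset h' Q2')"
        using majorizes_add[OF *(4) majorizes_refl[of Q2']] by simp
      show "majorizes (P0 + add_mset h' Q2') (P0 + P2')"
        using majorizes_add[OF majorizes_refl[of P0] m2'] by (simp add: h'_def)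
    qed
    ultimately have "add_mset a P1 = {#} \<or> P0 + P2' = {#}"
      by (intro indecomposableD[OF ind, of _ _ "add_mset b Q1" "Q0 + Q2'"])
        (use A B P2 Q2 * in auto)
    then show False using m \<open>Q0 \<noteq> {#}\<close> by (auto simp: majorizes_def)
  qed
  have m1': "majorizes (add_mset b Q) (add_mset h' (add_mset a P))"
    using majorizes_trans[OF _ pair[of P]] m1 by (simp add: add_mset_commute)
  have hist': "\<exists>P0 P1 Q0 Q1. add_mset a P = P0 + P1 \<and> add_mset b Q = Q0 + Q1 \<and> Q0 \<noteq> {#} \<and>
        majorizes Q0 (add_mset x P0) \<and> majorizes (add_mset x Q1) (add_mset h' P1)"
    if "x \<in> insert h0 (insert h' H)" for x
  proof (cases "x = h'")
    case True
    then show ?thesis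
      using m1' by (intro exI[of _ "add_mset a P"] exI[of _ "{#}"] exI[of _ "add_mset b Q"]) auto
  next
    case False
    then have "x \<in> insert h0 H" using that by simp
    from hist[OF this] obtain P0 P1 Q0 Q1 where *: "P = P0 + P1" "Q = Q0 + Q1" "Q0 \<noteq> {#}"
      "majorizes Q0 (add_mset x P0)" "majorizes (add_mset x Q1) (add_mset h P1)" by blast
    then show ?thesis using extend[OF *(5)]
      by (intro exI[of _ P0] exI[of _ "add_mset a P1"] exI[of _ Q0] exI[of _ "add_mset b Q1"]) auto
  qed
  have "finite H" using H(1) finite_subset by blast
  then have "card (insert h' H) = Suc k" using new H by simp
  moreover have "A = add_mset a P + P2'" "B = add_mset b Q + Q2'" using A B P2 Q2 by simp_all
  moreover have "insert h' H \<subseteq> {1..r - 1}" "h0 \<notin> insert h' H" using H h'_range new by auto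
  moreover have "size (add_mset a P) = Suc k" "h' \<in> insert h0 (insert h' H)" using sP by simp_all
  moreover note m1' m2'[folded h'_def] ballI[OF hist']
  ultimately show ?case
    by - (rule exI[of _ h'], rule exI[of _ "add_mset a P"], rule exI[of _ P2'],
        rule exI[of _ "add_mset b Q"], rule exI[of _ Q2'], rule exI[of _ "insert h' H"],
        intro conjI; assumption)
qed

text \<open>A chain of length \<open>size A - 1\<close> from \<open>b\<close> yields that many
  distinct values in \<open>{1..r - 1}\<close>, all different from \<open>b\<close>.\<close>

lemma indecomposable_size:
  assumes "majorizes B A" "indecomposable B A" "\<And>x. x \<in># B \<Longrightarrow> 0 \<le> x \<and> x \<le> r"
    and "b \<in># B" "r \<ge> 1"
  shows "int (size A) \<le> r" and "int (size A) = r \<Longrightarrow> b = 0 \<or> b = r"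
proof -
  have pos: "size A > 0" using assms by (auto simp: majorizes_def nonempty_has_size[symmetric])
  then obtain H where H: "H \<subseteq> {1..r - 1}" "card H = size A - 1" "b \<notin> H"
    using majorizes_chain[OF assms(1,2,4,3), of "size A - 1"] by auto
  have card: "card H \<le> nat (r - 1)" using card_mono[OF _ H(1)] by simp
  then show "int (size A) \<le> r" using H pos assms by linarith
  assume "int (size A) = r"
  then have "card H = card {1..r - 1}" using H pos by simp
  then have "H = {1..r - 1}" using H by (intro card_subset_eq) auto
  then show "b = 0 \<or> b = r" using H(3) assms(3)[OF assms(4)] by auto
qed

section \<open>Extreme columns and zero sums modulo \<open>r\<close>\<close>

lemma deviation_above:
  "(\<And>x. x \<in># A \<Longrightarrow> x \<le> t) \<Longrightarrow> deviation A t = int (size A) * t - \<Sum>\<^sub># A"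
  by (induction A) (auto simp: algebra_simps)

text \<open>For \<open>t\<close> outside \<open>{0..r}\<close> the deviation depends only on size
  and sum.\<close>

lemma majorizes_if_deviation_le:
  assumes "size B = size A" "\<Sum>\<^sub># B = \<Sum>\<^sub># A" "\<And>x. x \<in># A + B \<Longrightarrow> 0 \<le> x \<and> x \<le> r"
    and "\<And>t. 0 \<le> t \<Longrightarrow> t \<le> r \<Longrightarrow> deviation A t \<le> deviation B t"
  shows "majorizes B A"
  unfolding majorizes_def
proof (intro conjI allI assms(1,2))
  fix t
  consider "t < 0" | "t > r" | "0 \<le> t" "t \<le> r" by linarith
  then show "deviation A t \<le> deviation B t"
  proof cases
    case 1
    then have "\<And>x. x \<in># A + B \<Longrightarrow> t \<le> x" using assms(3) by force
    then show ?thesis using assms(1,2) by (simp add: deviation_below)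
  next
    case 2
    then have "\<And>x. x \<in># A + B \<Longrightarrow> x \<le> t" using assms(3) by force
    then show ?thesis using assms(1,2) by (simp add: deviation_above)
  qed (use assms(4) in auto)
qed

text \<open>On \<open>{0..r}\<close> the convex function |x - t| lies below its chord through 0 and
  \<open>r\<close>; the factor \<open>r\<close> clears the denominator.\<close>

lemma deviation_le_chord:
  assumes "0 \<le> t" "t \<le> r" "\<And>x. x \<in># A \<Longrightarrow> 0 \<le> x \<and> x \<le> r"
  shows "r * deviation A t \<le> int (size A) * (r * t) + (r - 2 * t) * \<Sum>\<^sub># A"
  using assms(3)
proof (induction A)
  case (add x A)
  have "r * \<bar>x - t\<bar> \<le> r * t + (r - 2 * t) * x"
  proof (cases "t \<le> x")
    case True
    have "t * x \<le> t * r" using add.prems[of x] assms by (intro mult_left_mono) auto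
    then show ?thesis using True by (simp add: algebra_simps)
  next
    case False
    have "x * t \<le> x * r" using add.prems[of x] assms by (intro mult_left_mono) auto
    then show ?thesis using False by (simp add: algebra_simps)
  qed
  moreover have "r * deviation A t \<le> int (size A) * (r * t) + (r - 2 * t) * \<Sum>\<^sub># A"
    using add by simp
  ultimately show ?case by (simp add: algebra_simps)
qed auto

lemma deviation_eq_chord:
  assumes "0 \<le> t" "t \<le> r" "\<And>x. x \<in># B \<Longrightarrow> x = 0 \<or> x = r"
  shows "r * deviation B t = int (size B) * (r * t) + (r - 2 * t) * \<Sum>\<^sub># B"
  using assms(3)
proof (induction B)
  case (add x B)
  have "r * \<bar>x - t\<bar> = r * t + (r - 2 * t) * x"
    using add.prems[of x] assms by (auto simp: algebra_simps)
  then show ?case using add by (simp add: algebra_simps)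
qed auto

text \<open>\<open>B\<close> attains the chord bound, which depends only on size and sum.\<close>

lemma majorizes_extreme:
  assumes "r \<ge> 1" "size B = size A" "\<Sum>\<^sub># B = \<Sum>\<^sub># A"
    and "\<And>x. x \<in># A \<Longrightarrow> 0 \<le> x \<and> x \<le> r" "\<And>x. x \<in># B \<Longrightarrow> x = 0 \<or> x = r"
  shows "majorizes B A"
proof (rule majorizes_if_deviation_le[OF assms(2,3)])
  show "0 \<le> x \<and> x \<le> r" if "x \<in># A + B" for x using that assms by force
  fix t assume "0 \<le> t" "t \<le> r"
  then have "r * deviation A t \<le> r * deviation B t"
    using deviation_le_chord[of t r A] deviation_eq_chord[of t r B] assms by simp
  then show "deviation A t \<le> deviation B t" using assms(1) by simp
qed

lemma sum_mset_bounds: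
  "(\<And>x. x \<in># A \<Longrightarrow> 0 \<le> x \<and> x \<le> r) \<Longrightarrow> 0 \<le> \<Sum>\<^sub># A \<and> \<Sum>\<^sub># A \<le> r * int (size A)"
  by (induction A) (force simp: algebra_simps)+

text \<open>If \<open>r\<close> divides the sum of \<open>A1\<close>, it also divides that of
  \<open>A2\<close>, because the sum of \<open>B\<close> is a multiple of \<open>r\<close>. Each
  part then gets its share of the columns 0 and \<open>r\<close> of \<open>B\<close>, and
  \<open>majorizes_extreme\<close> gives a decomposition.\<close>

lemma indecomposable_no_zero_sum:
  assumes ind: "indecomposable B A" and maj: "majorizes B A" and r: "r \<ge> 1"
    and rA: "\<And>x. x \<in># A \<Longrightarrow> 0 \<le> x \<and> x \<le> r" and rB: "\<And>x. x \<in># B \<Longrightarrow> x = 0 \<or> x = r"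
    and A: "A = A1 + A2" and ne: "A1 \<noteq> {#}" "A2 \<noteq> {#}"
  shows "\<not> r dvd \<Sum>\<^sub># A1"
proof
  assume "r dvd \<Sum>\<^sub># A1"
  then obtain y1 where y1: "\<Sum>\<^sub># A1 = r * y1" by (elim dvdE)
  define u v where "u = count B 0" and "v = count B r"
  have B: "B = replicate_mset u 0 + replicate_mset v r"
  proof (rule multiset_eqI)
    fix x
    show "count B x = count (replicate_mset u 0 + replicate_mset v r) x"
      using rB[of x] r by (cases "x \<in># B") (auto simp: u_def v_def not_in_iff)
  qed
  have sB: "\<Sum>\<^sub># B = r * int v" "size B = u + v" by (simp_all add: B algebra_simps)
  define y2 where "y2 = int v - y1"
  have y2: "\<Sum>\<^sub># A2 = r * y2"
    using maj A y1 sB by (simp add: majorizes_def y2_def algebra_simps)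
  have b1: "0 \<le> y1" "y1 \<le> int (size A1)"
    using sum_mset_bounds[of A1 r] rA A y1 r by (auto simp: zero_le_mult_iff)
  have b2: "0 \<le> y2" "y2 \<le> int (size A2)"
    using sum_mset_bounds[of A2 r] rA A y2 r by (auto simp: zero_le_mult_iff)
  \<comment> \<open>\<open>y\<close> columns of height \<open>r\<close>, padded with zeros to the
    size of \<open>C\<close>; \<open>b1\<close> and \<open>b2\<close> ensure that the subtraction
    does not truncate.\<close>
  let ?B = "\<lambda>C y. replicate_mset (size C - nat y) 0 + replicate_mset (nat y) r :: int multiset"
  have "majorizes (?B A1 y1) A1"
    by (rule majorizes_extreme[OF r]) (use b1 y1 rA A in \<open>auto split: if_splits\<close>)
  moreover have "majorizes (?B A2 y2) A2"
    by (rule majorizes_extreme[OF r]) (use b2 y2 rA A in \<open>auto split: if_splits\<close>)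
  moreover have "B = ?B A1 y1 + ?B A2 y2"
  proof -
    have "u = (size A1 - nat y1) + (size A2 - nat y2)" "v = nat y1 + nat y2"
      using maj sB A b1 b2 by (auto simp: majorizes_def y2_def)
    then show ?thesis unfolding B by (intro multiset_eqI) simp
  qed
  ultimately show False using indecomposableD[OF ind A] ne by blast
qed

text \<open>Pigeonhole on \<open>y\<close> and the \<open>r - 1\<close> proper initial sums of the
  sequence \<open>x\<close>, \<open>y\<close>, \<open>cs\<close>: these \<open>r\<close> numbers
  avoid residue 0, so two agree modulo \<open>r\<close>. Unless these are \<open>x\<close> and
  \<open>y\<close> themselves, their difference is a proper zero sum.\<close>

lemma minimal_zero_sum_constant:
  assumes size: "int (size A) = r" and rA: "\<And>x. x \<in># A \<Longrightarrow> 0 \<le> x \<and> x \<le> r"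
    and nz: "\<And>A1 A2. A = A1 + A2 \<Longrightarrow> A1 \<noteq> {#} \<Longrightarrow> A2 \<noteq> {#} \<Longrightarrow> \<not> r dvd \<Sum>\<^sub># A1"
    and xy: "x \<in># A" "y \<in># A"
  shows "x = y"
proof (rule ccontr)
  assume "x \<noteq> y"
  obtain A' where A': "A = add_mset x A'" using xy by (meson multi_member_split)
  then have "y \<in># A'" using xy \<open>x \<noteq> y\<close> by auto
  then obtain C where "A' = add_mset y C" by (meson multi_member_split)
  moreover obtain cs where "C = mset cs" using ex_mset by metis
  ultimately have A: "A = add_mset x (add_mset y (mset cs))" using A' by simp
  define R where "R = size A"
  have R: "r = int R" "R = length cs + 2" using size A by (simp_all add: R_def)
  define S where "S i = x + sum_list (take (i - 1) (y # cs))" for i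
  define f where "f i = (if i = 0 then y else S i)" for i :: nat
  have fnz: "\<not> r dvd f i" if "i < R" for i
  proof (cases "i = 0")
    case True
    then show ?thesis using nz[of "{#y#}" "add_mset x (mset cs)"] A by (simp add: f_def)
  next
    case False
    let ?D = "mset (drop (i - 1) (y # cs))"
    have "mset (y # cs) = mset (take (i - 1) (y # cs)) + ?D"
      by (metis append_take_drop_id mset_append)
    moreover have "length (drop (i - 1) (y # cs)) > 0" using that R False by auto
    then have "?D \<noteq> {#}" by auto
    ultimately show ?thesis
      using nz[of "add_mset x (mset (take (i - 1) (y # cs)))" ?D] A False
      by (simp add: f_def S_def sum_mset_sum_list flip: mset.simps(2))
  qed
  have "(\<lambda>i. f i mod r) ` {..<R} \<subseteq> {1..r - 1}"
  proof clarify
    fix i assume "i < R"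
    then have "f i mod r \<noteq> 0" using fnz by (simp add: dvd_eq_mod_eq_0)
    moreover have "0 \<le> f i mod r" "f i mod r < r" using R by auto
    ultimately show "f i mod r \<in> {1..r - 1}" by auto
  qed
  then have "card ((\<lambda>i. f i mod r) ` {..<R}) \<le> card {1..r - 1}" by (intro card_mono) auto
  also have "\<dots> < card {..<R}" using R by simp
  finally have "\<not> inj_on (\<lambda>i. f i mod r) {..<R}" by (rule pigeonhole)
  then obtain i j where "i < R" "j < R" "i \<noteq> j" "f i mod r = f j mod r"
    by (auto simp: inj_on_def)
  then obtain i j where ij: "i < j" "j < R" "f i mod r = f j mod r"
    by (metis linorder_neqE_nat)
  then have dvd: "r dvd f j - f i" by (metis mod_eq_dvd_iff)
  show False
  proof (cases "i = 0")
    case True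
    show False
    proof (cases "j = 1")
      case True
      have "x mod r = y mod r" using \<open>i = 0\<close> True ij by (simp add: f_def S_def)
      moreover have "\<not> r dvd x" "\<not> r dvd y" using fnz[of 0] fnz[of 1] R by (simp_all add: f_def S_def)
      then have "x \<noteq> 0" "x \<noteq> r" "y \<noteq> 0" "y \<noteq> r" by auto
      then have "x mod r = x" "y mod r = y" using rA[of x] rA[of y] xy by auto
      ultimately show False using \<open>x \<noteq> y\<close> by simp
    next
      case False
      \<comment> \<open>Here \<open>S j - y\<close> is the sum of \<open>x\<close> and the first
        \<open>k\<close> entries of \<open>cs\<close>.\<close>
      then obtain k where k: "j = Suc (Suc k)" using True ij by (metis One_nat_def not0_implies_Suc less_not_refl)
      have "mset cs = mset (take k cs) + mset (drop k cs)"
        by (metis append_take_drop_id mset_append)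
      then show False
        using nz[of "add_mset x (mset (take k cs))" "add_mset y (mset (drop k cs))"] A dvd True k
        by (simp add: f_def S_def sum_mset_sum_list)
    qed
  next
    case False
    \<comment> \<open>The consecutive entries that \<open>S j\<close> has beyond
      \<open>S i\<close>.\<close>
    define M where "M = drop (i - 1) (take (j - 1) (y # cs))"
    have split: "take (j - 1) (y # cs) = take (i - 1) (y # cs) @ M"
      using ij append_take_drop_id[of "i - 1" "take (j - 1) (y # cs)"]
      by (simp add: M_def min_absorb1 diff_le_mono)
    have "f j - f i = sum_list M"
      using False ij split by (simp add: f_def S_def)
    moreover have "length M > 0" using False ij R by (auto simp: M_def)
    then have "M \<noteq> []" by auto
    moreover have "mset (y # cs) = mset (take (i - 1) (y # cs)) + mset M + mset (drop (j - 1) (y # cs))"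
      by (metis append_take_drop_id mset_append split)
    ultimately show False
      using nz[of "mset M" "add_mset x (mset (take (i - 1) (y # cs)) + mset (drop (j - 1) (y # cs)))"] A dvd
      by (simp add: sum_mset_sum_list flip: mset.simps(2))
  qed
qed

section \<open>Partitions as multisets of columns\<close>

text \<open>Row lengths of the Young diagram with column heights \<open>A\<close>; columns of height
  0 do not affect them.\<close>

definition partition_of_columns :: "nat \<Rightarrow> int multiset \<Rightarrow> nat \<Rightarrow> real" where
  "partition_of_columns r A i =
     (if i \<in> {1..r} then real (size (filter_mset (\<lambda>x. int i \<le> x) A)) else 0)"

lemma partition_of_columns_add:
  "partition_of_columns r (A + B) = partition_of_columns r A + partition_of_columns r B"
  by (auto simp: partition_of_columns_def fun_eq_iff)

lemma sum_min_Suc: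
  "(\<Sum>x\<in>#A. min x (int (Suc t))) =
     (\<Sum>x\<in>#A. min x (int t)) + int (size (filter_mset (\<lambda>x. int (Suc t) \<le> x) A))"
  by (induction A) auto

lemma sum_min_0: "(\<And>x. x \<in># A \<Longrightarrow> 0 \<le> x) \<Longrightarrow> (\<Sum>x\<in>#A. min x 0) = (0::int)"
  by (induction A) auto

text \<open>Both sides count the cells in the first \<open>t\<close> rows.\<close>

lemma sum_partition_of_columns:
  assumes "t \<le> r" "\<And>x. x \<in># A \<Longrightarrow> 0 \<le> x"
  shows "(\<Sum>i=1..t. partition_of_columns r A i) = real_of_int (\<Sum>x\<in>#A. min x (int t))"
  using assms(1)
proof (induction t)
  case 0
  then show ?case using sum_min_0[OF assms(2)] by simp
next
  case (Suc t)
  then show ?case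
    unfolding sum_min_Suc by (simp add: partition_of_columns_def)
qed

lemma deviation_eq_sum_min:
  "deviation A t = \<Sum>\<^sub># A + int (size A) * t - 2 * (\<Sum>x\<in>#A. min x t)"
  by (induction A) (auto simp: algebra_simps)

lemma sum_min_upper: "(\<And>x. x \<in># A \<Longrightarrow> x \<le> t) \<Longrightarrow> (\<Sum>x\<in>#A. min x t) = \<Sum>\<^sub># (A :: int multiset)"
  by (induction A) auto

lemma sum_partition_of_columns_total:
  assumes "\<And>x. x \<in># A \<Longrightarrow> 0 \<le> x \<and> x \<le> int r"
  shows "(\<Sum>i=1..r. partition_of_columns r A i) = real_of_int (\<Sum>\<^sub># A)"
  using sum_partition_of_columns[of r r A] sum_min_upper[of A "int r"] assms by simp

lemma decreasing_partition_of_columns: "decreasing_nonneg r (partition_of_columns r A)"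
proof -
  have "size (filter_mset (\<lambda>x. int (Suc i) \<le> x) A) \<le> size (filter_mset (\<lambda>x. int i \<le> x) A)" for i
    by (induction A) auto
  then show ?thesis by (auto simp: decreasing_nonneg_def partition_of_columns_def)
qed

lemma partition_of_columns_zvec: "partition_of_columns r A \<in> zvec r"
  by (auto simp: zvec_def rvec_def partition_of_columns_def)

text \<open>By \<open>deviation_eq_sum_min\<close>, more cells in the first \<open>t\<close> rows
  means a smaller deviation at \<open>t\<close>. Conjugation thus reverses dominance.\<close>

lemma majorizes_iff_Kostka_Z:
  assumes "size B = size A"
    and rA: "\<And>x. x \<in># A \<Longrightarrow> 0 \<le> x \<and> x \<le> int r" and rB: "\<And>x. x \<in># B \<Longrightarrow> 0 \<le> x \<and> x \<le> int r"
  shows "majorizes B A \<longleftrightarrow> (partition_of_columns r A, partition_of_columns r B) \<in> Kostka_Z r"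
proof -
  let ?l = "partition_of_columns r A" and ?m = "partition_of_columns r B"
  have tot: "(\<Sum>i=1..r. ?l i) = (\<Sum>i=1..r. ?m i) \<longleftrightarrow> \<Sum>\<^sub># A = \<Sum>\<^sub># B"
    using sum_partition_of_columns_total[OF rA] sum_partition_of_columns_total[OF rB] by simp
  have part: "(\<Sum>i=1..t. ?m i) \<le> (\<Sum>i=1..t. ?l i) \<longleftrightarrow> deviation A (int t) \<le> deviation B (int t)"
    if "t \<le> r" "\<Sum>\<^sub># A = \<Sum>\<^sub># B" for t
    using sum_partition_of_columns[OF that(1), of A] sum_partition_of_columns[OF that(1), of B]
      rA rB that(2) assms(1) by (simp add: deviation_eq_sum_min)
  have zvec: "?l \<in> zvec r" "?m \<in> zvec r" by (rule partition_of_columns_zvec)+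
  then have rvec: "?l \<in> rvec r" "?m \<in> rvec r" by (auto simp: zvec_def)
  show ?thesis
  proof
    assume "majorizes B A"
    then show "(?l, ?m) \<in> Kostka_Z r"
      using zvec rvec tot part decreasing_partition_of_columns[of r]
      by (auto simp: Kostka_Z_def Kostka_def majorizes_def)
  next
    assume K: "(?l, ?m) \<in> Kostka_Z r"
    then have eq: "(\<Sum>i=1..r. ?l i) = (\<Sum>i=1..r. ?m i)"
      and le: "\<And>t. t \<in> {1..r - 1} \<Longrightarrow> (\<Sum>i=1..t. ?m i) \<le> (\<Sum>i=1..t. ?l i)"
      by (auto simp: Kostka_Z_def Kostka_def)
    show "majorizes B A"
    proof (rule majorizes_if_deviation_le[OF assms(1)])
      show "\<Sum>\<^sub># B = \<Sum>\<^sub># A" using eq tot by simp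
      show "0 \<le> x \<and> x \<le> int r" if "x \<in># A + B" for x using that rA rB by auto
      fix t assume t: "0 \<le> t" "t \<le> int r"
      then obtain s where s: "t = int s" "s \<le> r" by (metis nonneg_int_cases of_nat_le_iff)
      \<comment> \<open>The ends \<open>s = 0\<close> and \<open>s = r\<close> lie outside the
        dominance inequalities; they come from empty sums and equal totals.\<close>
      have "(\<Sum>i=1..s. ?m i) \<le> (\<Sum>i=1..s. ?l i)"
        using le[of s] eq s(2) by (cases "s = 0 \<or> s = r") auto
      then show "deviation A t \<le> deviation B t" using part[OF s(2)] eq tot s by simp
    qed
  qed
qed

lemma decreasing_nonnegD:
  assumes "decreasing_nonneg r v" "1 \<le> i" "i \<le> j" "j \<le> r"
  shows "v j \<le> v i"
  using assms(3,4)
proof (induction j rule: dec_induct)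
  case (step j)
  have "v (j + 1) \<le> v j" using assms(1,2) step by (auto simp: decreasing_nonneg_def)
  then show ?case using step by simp
qed simp

text \<open>The columns are the parts of the conjugate partition; zero columns pad their number to \<open>n\<close>.\<close>

lemma ex_columns:
  assumes dec: "decreasing_nonneg r v" and z: "v \<in> zvec r" and n: "r \<ge> 1" "v 1 \<le> real n"
  obtains A where "size A = n" "partition_of_columns r A = v" "\<And>x. x \<in># A \<Longrightarrow> 0 \<le> x \<and> x \<le> int r"
    "v 1 = real n \<Longrightarrow> \<forall>x\<in>#A. 1 \<le> x"
proof
  define col where "col j = int (card {i\<in>{1..r}. real j \<le> v i})" for j
  let ?A = "image_mset col (mset_set {1..n})"
  \<comment> \<open>As \<open>v\<close> decreases, the rows of length at least \<open>j\<close> form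
    an initial segment, so their number determines them.\<close>
  have col: "int i \<le> col j \<longleftrightarrow> real j \<le> v i" if i: "i \<in> {1..r}" for i j
  proof
    assume "real j \<le> v i"
    then have "{1..i} \<subseteq> {i\<in>{1..r}. real j \<le> v i}"
      using decreasing_nonnegD[OF dec, of _ i] i by force
    then have "card {1..i} \<le> card {i\<in>{1..r}. real j \<le> v i}" by (intro card_mono) auto
    then show "int i \<le> col j" by (simp add: col_def)
  next
    assume le: "int i \<le> col j"
    show "real j \<le> v i"
    proof (rule ccontr)
      assume "\<not> real j \<le> v i"
      then have "{i\<in>{1..r}. real j \<le> v i} \<subseteq> {1..<i}"
        using order_trans[OF _ decreasing_nonnegD[OF dec, of i]] i by (auto simp: not_le[symmetric])
      then have "card {i\<in>{1..r}. real j \<le> v i} \<le> card {1..<i}" by (intro card_mono) auto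
      then show False using le i by (auto simp: col_def)
    qed
  qed
  show "size ?A = n" by simp
  show "partition_of_columns r ?A = v"
  proof
    fix i
    show "partition_of_columns r ?A i = v i"
    proof (cases "i \<in> {1..r}")
      case False
      then show ?thesis using z by (auto simp: partition_of_columns_def zvec_def rvec_def)
    next
      case True
      then have "v i \<in> \<int>" "v i \<ge> 0" using z dec by (auto simp: zvec_def decreasing_nonneg_def)
      then obtain k where k: "v i = real k" by (metis Ints_cases of_int_0_le_iff nonneg_int_cases of_int_of_nat_eq)
      have "v i \<le> v 1" using decreasing_nonnegD[OF dec, of 1 i] True by simp
      then have "k \<le> n" using k n by simp
      have colk: "int i \<le> col j \<longleftrightarrow> j \<le> k" for j using col[OF True, of j] k by simp
      have "filter_mset (\<lambda>x. int i \<le> x) ?A = image_mset col (mset_set {j\<in>{1..n}. int i \<le> col j})"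
        by (simp add: filter_mset_image_mset filter_mset_mset_set)
      also have "{j\<in>{1..n}. int i \<le> col j} = {1..k}"
        using \<open>k \<le> n\<close> unfolding colk by auto
      finally show ?thesis using True k by (simp add: partition_of_columns_def)
    qed
  qed
  show "0 \<le> x \<and> x \<le> int r" if "x \<in># ?A" for x
  proof -
    have "card {i\<in>{1..r}. real j \<le> v i} \<le> card {1..r}" for j by (intro card_mono) auto
    then show ?thesis using that by (auto simp: col_def)
  qed
  show "\<forall>x\<in>#?A. 1 \<le> x" if "v 1 = real n"
    using that col[of 1] n by auto
qed

lemma partition_of_columns_nonzero:
  assumes "r \<ge> 1" "A \<noteq> {#}" "\<And>x. x \<in># A \<Longrightarrow> 1 \<le> x"
  shows "partition_of_columns r A \<noteq> 0"
proof -
  have "filter_mset (\<lambda>x. 1 \<le> x) A = A" using assms(3) by (simp add: filter_mset_eq_conv)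
  then have "partition_of_columns r A 1 = real (size A)"
    using assms(1) by (simp add: partition_of_columns_def)
  then have "partition_of_columns r A 1 \<noteq> 0 1" using assms(2) by simp
  then show ?thesis by metis
qed

section \<open>From Hilbert basis elements to columns\<close>

text \<open>All columns of \<open>A\<close> are positive, so nonempty parts of \<open>A\<close> give
  nonzero summands; \<open>B\<close> may contain zero columns.\<close>

lemma hilbert_basis_indecomposable:
  assumes hb: "(partition_of_columns r A, partition_of_columns r B) \<in> hilbert_basis (Kostka_Z r)"
    and r: "r \<ge> 1" and rA: "\<And>x. x \<in># A \<Longrightarrow> 1 \<le> x \<and> x \<le> int r"
    and rB: "\<And>x. x \<in># B \<Longrightarrow> 0 \<le> x \<and> x \<le> int r"
  shows "indecomposable B A"
  unfolding indecomposable_def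
proof (intro allI impI, rule ccontr)
  fix A1 A2 B1 B2
  assume A: "A = A1 + A2" and B: "B = B1 + B2" and m: "majorizes B1 A1" "majorizes B2 A2"
    and ne: "\<not> (A1 = {#} \<or> A2 = {#})"
  let ?x1 = "(partition_of_columns r A1, partition_of_columns r B1)"
  let ?x2 = "(partition_of_columns r A2, partition_of_columns r B2)"
  have "?x1 \<in> Kostka_Z r"
    using m(1) rA rB A B by (subst majorizes_iff_Kostka_Z[symmetric]) (force simp: majorizes_def)+
  moreover have "?x2 \<in> Kostka_Z r"
    using m(2) rA rB A B by (subst majorizes_iff_Kostka_Z[symmetric]) (force simp: majorizes_def)+
  moreover have "?x1 \<noteq> 0" "?x2 \<noteq> 0"
    using partition_of_columns_nonzero[OF r] ne A rA by (auto simp: zero_prod_def)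
  moreover have "(partition_of_columns r A, partition_of_columns r B) = ?x1 + ?x2"
    by (simp add: A B partition_of_columns_add)
  ultimately show False using hb unfolding hilbert_basis_def by blast
qed

lemma rectangle_partition_of_columns:
  assumes "\<And>x y. x \<in># A \<Longrightarrow> y \<in># A \<Longrightarrow> x = y"
  shows "rectangle r (partition_of_columns r A)"
proof (cases "A = {#}")
  case True
  then show ?thesis by (simp add: rectangle_def partition_of_columns_def)
next
  case False
  then obtain a where "a \<in># A" by auto
  then have eq: "x = a" if "x \<in># A" for x using assms that by blast
  have "filter_mset (\<lambda>x. int i \<le> x) A = filter_mset (\<lambda>_. int i \<le> a) A" for i
    using eq by (intro filter_mset_cong) auto
  then have "partition_of_columns r A i \<in> {0, real (size A)}" for i
    by (simp add: partition_of_columns_def)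
  then show ?thesis unfolding rectangle_def by (metis empty_iff insert_iff)
qed

lemma rectangle_partition_of_extreme_columns:
  assumes "\<And>x. x \<in># B \<Longrightarrow> x = 0 \<or> x = int r"
  shows "rectangle r (partition_of_columns r B)"
proof -
  have "filter_mset (\<lambda>x. int i \<le> x) B = filter_mset (\<lambda>x. x = int r) B" if "i \<in> {1..r}" for i
  proof (rule filter_mset_cong)
    fix x assume "x \<in># B"
    then show "int i \<le> x \<longleftrightarrow> x = int r" using assms[of x] that by auto
  qed simp
  then show ?thesis by (auto simp: rectangle_def partition_of_columns_def)
qed

theorem theorem1p3:
  fixes r :: nat and l m :: "nat \<Rightarrow> real"
  assumes "r \<ge> 1"
    and "(l, m) \<in> hilbert_basis (Kostka_Z r)"
  shows "l 1 \<le> real r \<and> (l 1 = real r \<longrightarrow> rectangle r l \<and> rectangle r m)"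
proof -
  have K: "(l, m) \<in> Kostka_Z r" using assms(2) by (simp add: hilbert_basis_def)
  then have dec: "decreasing_nonneg r l" "decreasing_nonneg r m" and z: "l \<in> zvec r" "m \<in> zvec r"
    and le: "\<And>t. t \<in> {1..r - 1} \<Longrightarrow> (\<Sum>i=1..t. l i) \<ge> (\<Sum>i=1..t. m i)"
    and eq: "(\<Sum>i=1..r. l i) = (\<Sum>i=1..r. m i)"
    by (auto simp: Kostka_Z_def Kostka_def)
  have "l 1 \<in> \<int>" "l 1 \<ge> 0" using z dec assms(1) by (auto simp: zvec_def decreasing_nonneg_def)
  then obtain n where n: "l 1 = real n"
    by (metis Ints_cases of_int_0_le_iff nonneg_int_cases of_int_of_nat_eq)
  \<comment> \<open>Dominance at \<open>t = 1\<close>, except that for \<open>r = 1\<close> only the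
    equality of totals is available.\<close>
  have ml: "m 1 \<le> real n"
    using le[of 1] eq assms(1) n by (cases "r = 1") auto
  obtain A where A: "size A = n" "partition_of_columns r A = l"
      "\<And>x. x \<in># A \<Longrightarrow> 0 \<le> x \<and> x \<le> int r" "\<forall>x\<in>#A. 1 \<le> x"
    using ex_columns[OF dec(1) z(1) assms(1), of n] n by auto
  obtain B where B: "size B = n" "partition_of_columns r B = m"
      "\<And>x. x \<in># B \<Longrightarrow> 0 \<le> x \<and> x \<le> int r"
    using ex_columns[OF dec(2) z(2) assms(1) ml] by metis
  have maj: "majorizes B A"
    using majorizes_iff_Kostka_Z[of B A r] A B K by simp
  have ind: "indecomposable B A"
    using hilbert_basis_indecomposable[of r A B] assms A B by simp
  show ?thesis
  proof (cases "n = 0")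
    case True
    then show ?thesis using n assms(1) by simp
  next
    case False
    then obtain b where b: "b \<in># B" using B(1) by fastforce
    have r: "int r \<ge> 1" using assms(1) by simp
    have "int n \<le> int r" using indecomposable_size(1)[OF maj ind B(3) b r] A(1) by simp
    moreover have "rectangle r l \<and> rectangle r m" if "n = r"
    proof -
      have ext: "x = 0 \<or> x = int r" if "x \<in># B" for x
        using indecomposable_size(2)[OF maj ind B(3) that r] A(1) \<open>n = r\<close> by simp
      have "x = y" if "x \<in># A" "y \<in># A" for x y
        by (rule minimal_zero_sum_constant[of A "int r", OF _ A(3) _ that])
          (use indecomposable_no_zero_sum[OF ind maj r A(3) ext] A(1) \<open>n = r\<close> in auto)
      then show ?thesis
        using rectangle_partition_of_columns[of A r] rectangle_partition_of_extreme_columns[of B r] ext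
          A(2) B(2) by simp
    qed
    ultimately show ?thesis using n by simp
  qed
qed

end
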